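(* Let $g\in\mathbb{N}$, $h=1$, and let $G\in\mathcal{H}$ (the $g$-golden ratio recurrence $G_{k+2}=gG_{k+1}+G_k$). (a) If $G_1=1$ and $G_2\le g$, then $\#R_G(X)=X$. If $G_1=1$ and $G_2>g$, then $G$ has the unique expansion property under $\mathcal{E}$, and $p=r<1$. (b) If $G_2=1$ and $G_1\le g^2+1$, then $\#R_G(X)=X+O(1)$. If $G_2=1$ and $G_1>g^2+1$, then $G$ has the unique expansion property under $\mathcal{E}$, and $p=r<1$.
   Context: $\mathbb{N}$ is the set of positive integers and $\mathbb{N}_0=\mathbb{N}\cup\{0\}$. With $h=1$, $\mathcal{H}$ is the collection of sequences $G=(G_k)_{k\ge1}$ of positive integers such that $G_{k+2}=gG_{k+1}+G_k$ for all $k\in\mathbb{N}$ and $G_1,G_2$ are distinct and coprime. A coefficient tuple is an infinite tuple $\epsilon=(\epsilon_1,\epsilon_2,\dots)$ of non-negative integers with only finitely many nonzero entries; a finite tuple is identified with an infinite one by appending zeros. Put $\epsilon\cdot G:=\sum_{k\ge1}\epsilon_kG_k$. For $h=1$ the semi-proper blocks are the finite tuples $(c)$ with $0\le c\le g-1$ and $(0,g)$. $\mathcal{E}_{\mathrm p}$ is the set of tuples obtained by concatenating (finitely many) semi-proper blocks; $\mathcal{E}_{\mathrm m}$ is the set of tuples $(g,\epsilon_2,\dots,\epsilon_\ell)$ with $(\epsilon_2,\dots,\epsilon_\ell)\in\mathcal{E}_{\mathrm p}$; $\mathcal{E}:=\mathcal{E}_{\mathrm p}\cup\mathcal{E}_{\mathrm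 m}$. $G$ has the unique expansion property under $\mathcal{E}$ if the map $\mathcal{E}\to\mathbb{N}_0$, $\epsilon\mapsto\epsilon\cdot G$, is injective. $R_G$ is the set of $n\in\mathbb{N}$ with $n=\epsilon\cdot G$ for some $\epsilon\in\mathcal{E}$, and $R_G(X):=\{n\in R_G:n\le X\}$ for $X\in\mathbb{N}$. $\alpha=\frac12(g+\sqrt{g^2+4})$ is the zero greater than $1$ of $x^2-gx-1$; $r:=\frac{(g+1)\alpha+1}{G_2\alpha+G_1}$; $p$ is the constant such that $\#R_G(X)=pX+O(1)$, i.e. $p=\lim_{X\to\infty}\#R_G(X)/X$. The $O$-notation is as $X\to\infty$ with $G$ fixed.
   Formalization: In (a), for G_1=1 and G_2=g+1 one has p=r=1, so "r<1" fails there; for G_2>g it is replaced by "r≤1, and r<1 unless G_2=g+1", while unique expansion and p=r are kept for all G_2>g. *)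

theory Defs
  imports Complex_Main "HOL-Library.Landau_Symbols"
begin

text \<open>
  Sequences and infinite tuples are functions on \<^typ>\<open>nat\<close> indexed from 1.  The value of a
  sequence at 0 is unconstrained and never used; an infinite coefficient tuple is 0 at 0, so that
  equality of functions is equality of tuples.
\<close>

definition golden_recurrences :: "nat \<Rightarrow> (nat \<Rightarrow> nat) set" where
  "golden_recurrences g =
     {G. (\<forall>k\<ge>1. G k > 0) \<and> (\<forall>k\<ge>1. G (k + 2) = g * G (k + 1) + G k) \<and>
         G 1 \<noteq> G 2 \<and> coprime (G 1) (G 2)}"

definition infinite_tuple :: "nat list \<Rightarrow> nat \<Rightarrow> nat" where
  "infinite_tuple xs k = (if 1 \<le> k \<and> k \<le> length xs then xs ! (k - 1) else 0)"

text \<open>The sum runs over the support of the coefficient tuple, which is finite.\<close>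

definition eval_tuple :: "(nat \<Rightarrow> nat) \<Rightarrow> (nat \<Rightarrow> nat) \<Rightarrow> nat" where
  "eval_tuple G \<epsilon> = (\<Sum>k | 1 \<le> k \<and> \<epsilon> k \<noteq> 0. \<epsilon> k * G k)"

definition semi_proper_blocks :: "nat \<Rightarrow> nat list set" where
  "semi_proper_blocks g = {[c] | c. c < g} \<union> {[0, g]}"

definition proper_lists :: "nat \<Rightarrow> nat list set" where
  "proper_lists g = {concat bs | bs. set bs \<subseteq> semi_proper_blocks g}"

definition tuples_p :: "nat \<Rightarrow> (nat \<Rightarrow> nat) set" where
  "tuples_p g = infinite_tuple ` proper_lists g"

definition tuples_m :: "nat \<Rightarrow> (nat \<Rightarrow> nat) set" where
  "tuples_m g = {infinite_tuple (g # xs) | xs. xs \<in> proper_lists g}"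

definition tuples :: "nat \<Rightarrow> (nat \<Rightarrow> nat) set" where
  "tuples g = tuples_p g \<union> tuples_m g"

definition unique_expansion :: "nat \<Rightarrow> (nat \<Rightarrow> nat) \<Rightarrow> bool" where
  "unique_expansion g G \<longleftrightarrow> inj_on (eval_tuple G) (tuples g)"

definition represented :: "nat \<Rightarrow> (nat \<Rightarrow> nat) \<Rightarrow> nat set" where
  "represented g G = {n. n \<ge> 1 \<and> (\<exists>\<epsilon>\<in>tuples g. n = eval_tuple G \<epsilon>)}"

definition represented_upto :: "nat \<Rightarrow> (nat \<Rightarrow> nat) \<Rightarrow> nat \<Rightarrow> nat set" where
  "represented_upto g G X = {n \<in> represented g G. n \<le> X}"

definition golden_root :: "nat \<Rightarrow> real" where
  "golden_root g = (real g + sqrt (real g ^ 2 + 4)) / 2"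

text \<open>
  This ratio equals 1 when \<open>G 1 = 1\<close> and \<open>G 2 = g + 1\<close>, the case of the generalized
  Zeckendorf expansion, in which every positive integer is represented.
\<close>

definition expansion_ratio :: "nat \<Rightarrow> (nat \<Rightarrow> nat) \<Rightarrow> real" where
  "expansion_ratio g G =
     ((real g + 1) * golden_root g + 1) / (real (G 2) * golden_root g + real (G 1))"

text \<open>
  The value is meaningful only when the limit exists; a claim about it has to be accompanied by a
  claim that the counting function is asymptotically linear, with bounded error.
\<close>

definition representation_density :: "nat \<Rightarrow> (nat \<Rightarrow> nat) \<Rightarrow> real" where
  "representation_density g G = lim (\<lambda>X. real (card (represented_upto g G X)) / real X)"

end

theory Submission
  imports Defs
begin

text \<open>
  Write \<open>\<alpha>\<close> for the golden root, \<open>\<beta> = -1/\<alpha>\<close> for its conjugate, and split every sequence of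
  the recurrence along two basic solutions: \<open>G k = G 1 * B k + G 2 * A k\<close>, where \<open>B\<close> starts with
  \<open>1, 0\<close> and \<open>A\<close> with \<open>0, 1\<close>.  A coefficient tuple \<open>\<epsilon>\<close> thus becomes the lattice point
  \<open>(a, b) = (\<epsilon>\<cdot>A, \<epsilon>\<cdot>B)\<close>, and \<open>\<epsilon>\<cdot>G = G 2 * a + G 1 * b\<close>.

  Two facts about these points carry the proof.  First, the sequence \<open>H\<close> starting with
  \<open>1, g + 1\<close> is a numeration system: \<open>\<epsilon> \<mapsto> \<epsilon>\<cdot>H = (g + 1) * a + b\<close> is a bijection from the
  tuples onto the natural numbers (\<open>zeckendorf_ex\<close>, \<open>zeckendorf_unique\<close>).  Secondly,
  \<open>b + \<beta> * a = (\<Sum>k. \<epsilon> k * \<beta> ^ (k - 1))\<close> always lies in the open window from \<open>-1\<close> to \<open>\<alpha>\<close>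
  (\<open>window\<close>), of length \<open>1 + \<alpha>\<close>.

  As \<open>G 1\<close> and \<open>G 2\<close> are coprime, lattice points with the same value \<open>G 2 * a + G 1 * b\<close> differ by multiples of
  \<open>(G 1, - G 2)\<close>, so their window coordinates differ by multiples of \<open>G 2 + G 1 / \<alpha>\<close>.  The
  ratio \<open>r\<close> compares exactly the two lengths: \<open>r = (1 + \<alpha>) / (G 2 + G 1 / \<alpha>)\<close>.  If
  \<open>r \<le> 1\<close>, the step is too long for two points to fit into the window, and expansions are unique
  (\<open>unique_expansion_of_ratio_le_1\<close>).  If \<open>r \<ge> 1\<close>, the step is so short that for every \<open>n\<close> some
  lattice point with \<open>G 2 * a + G 1 * b = n\<close> hits the window, and for large \<open>n\<close>, where
  \<open>(g + 1) * a + b\<close> is nonnegative, this point comes from a tuple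
  (\<open>represented_of_ratio_ge_1\<close>).  Finally \<open>\<epsilon>\<cdot>H - r * (\<epsilon>\<cdot>G)\<close> is a constant times the window
  coordinate, hence bounded, so that counting values of \<open>\<epsilon>\<cdot>G\<close> amounts to counting values
  of \<open>\<epsilon>\<cdot>H\<close>, which are all the natural numbers (\<open>count_asymptotics\<close>).

  It remains to compare \<open>r\<close> with \<open>1\<close> in each case, which is elementary since
  \<open>g < \<alpha> < g + 1 / g\<close>; only the exact count for \<open>G 1 = 1\<close>, \<open>G 2 \<le> g\<close> uses the greedy algorithm
  for \<open>G\<close> itself.
\<close>

section \<open>Coefficient tuples described by a local condition on digits\<close>

text \<open>
  The condition at \<open>k = 0\<close> holds because the digit with index 0 is 0; this is what leaves the
  first digit free to be \<open>g\<close>, and so covers both kinds of tuples at once.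
\<close>

definition admissible :: "nat \<Rightarrow> (nat \<Rightarrow> nat) \<Rightarrow> bool" where
  "admissible g \<epsilon> \<longleftrightarrow> \<epsilon> 0 = 0 \<and> (\<exists>n. \<forall>k>n. \<epsilon> k = 0) \<and> (\<forall>k. \<epsilon> k \<le> g) \<and>
     (\<forall>k. \<epsilon> (Suc k) = g \<longrightarrow> \<epsilon> k = 0)"

definition good_list :: "nat \<Rightarrow> nat list \<Rightarrow> bool" where
  "good_list g xs \<longleftrightarrow> (\<forall>x\<in>set xs. x \<le> g) \<and> successively (\<lambda>x y. y = g \<longrightarrow> x = 0) xs"

lemma proper_lists_Nil: "[] \<in> proper_lists g"
  unfolding proper_lists_def by (force intro: exI[of _ "[]"])

lemma proper_lists_append:
  assumes "b \<in> semi_proper_blocks g" "xs \<in> proper_lists g"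
  shows "b @ xs \<in> proper_lists g"
proof -
  obtain bs where "set bs \<subseteq> semi_proper_blocks g" "xs = concat bs"
    using assms(2) unfolding proper_lists_def by auto
  thus ?thesis
    using assms(1) unfolding proper_lists_def by (force intro: exI[of _ "b # bs"])
qed

text \<open>
  Putting \<open>g\<close>, a nonzero entry, in front of the list expresses that the list itself must not
  start with \<open>g\<close>.
\<close>

lemma good_list_of_proper:
  assumes "g \<ge> 1" "xs \<in> proper_lists g"
  shows "good_list g (g # xs)"
proof -
  obtain bs where bs: "set bs \<subseteq> semi_proper_blocks g" "xs = concat bs"
    using assms(2) unfolding proper_lists_def by auto
  have "good_list g (c # concat bs)" if "c \<le> g" "c > 0 \<or> c < g" for c
    using bs(1) that
  proof (induction bs arbitrary: c)
    case Nil
    thus ?case by (simp add: good_list_def)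
  next
    case (Cons b bs)
    have ih: "good_list g (d # concat bs)" if "d \<le> g" for d
      using Cons.IH[of d] Cons.prems(1) that assms(1) by fastforce
    from Cons.prems(1) consider d where "b = [d]" "d < g" | "b = [0, g]"
      by (auto simp: semi_proper_blocks_def)
    thus ?case
    proof cases
      case 1
      thus ?thesis using ih[of d] Cons.prems by (auto simp: good_list_def)
    next
      case 2
      thus ?thesis using ih[of g] Cons.prems assms(1) by (auto simp: good_list_def)
    qed
  qed
  from this[of g] show ?thesis using bs assms(1) by simp
qed

lemma proper_of_good_list:
  assumes "g \<ge> 1" "good_list g xs" "xs = [] \<or> hd xs \<noteq> g"
  shows "xs \<in> proper_lists g"
  using assms(2,3)
proof (induction xs rule: length_induct)
  case (1 xs)
  show ?case
  proof (cases xs)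
    case Nil
    thus ?thesis by (simp add: proper_lists_Nil)
  next
    case (Cons c ys)
    have c: "c < g" using 1(2,3) Cons by (auto simp: good_list_def)
    have ys: "good_list g ys" using 1(2) Cons by (auto simp: good_list_def successively_Cons)
    show ?thesis
    proof (cases "ys \<noteq> [] \<and> hd ys = g")
      case False
      hence "ys \<in> proper_lists g" using 1(1) Cons ys by auto
      from proper_lists_append[OF _ this, of "[c]"] show ?thesis
        using c Cons by (auto simp: semi_proper_blocks_def)
    next
      case True
      then obtain zs where zs: "ys = g # zs" by (cases ys) auto
      have "c = 0" using 1(2) Cons zs by (auto simp: good_list_def)
      have "good_list g zs" using ys zs by (auto simp: good_list_def successively_Cons)
      moreover have "zs = [] \<or> hd zs \<noteq> g"
        using ys zs assms(1) by (cases zs) (auto simp: good_list_def)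
      ultimately have "zs \<in> proper_lists g" using 1(1) Cons zs proper_lists_Nil by auto
      from proper_lists_append[OF _ this, of "[0, g]"] show ?thesis
        using \<open>c = 0\<close> Cons zs by (auto simp: semi_proper_blocks_def)
    qed
  qed
qed

lemma tuples_eq_good_lists:
  assumes "g \<ge> 1"
  shows "tuples g = infinite_tuple ` {xs. good_list g xs}"
proof -
  have "good_list g xs \<longleftrightarrow> xs \<in> proper_lists g \<or> (\<exists>ys \<in> proper_lists g. xs = g # ys)" for xs
  proof
    assume xs: "good_list g xs"
    show "xs \<in> proper_lists g \<or> (\<exists>ys \<in> proper_lists g. xs = g # ys)"
    proof (cases "xs = [] \<or> hd xs \<noteq> g")
      case True
      thus ?thesis using proper_of_good_list[OF assms xs] by blast
    next
      case False
      then obtain ys where ys: "xs = g # ys" by (cases xs) auto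
      have "good_list g ys" using xs ys by (auto simp: good_list_def successively_Cons)
      moreover have "ys = [] \<or> hd ys \<noteq> g"
        using xs ys assms by (cases ys) (auto simp: good_list_def)
      ultimately show ?thesis using proper_of_good_list[OF assms] ys by blast
    qed
  next
    assume "xs \<in> proper_lists g \<or> (\<exists>ys \<in> proper_lists g. xs = g # ys)"
    moreover have "good_list g ys" if "good_list g (g # ys)" for ys
      using that by (cases ys) (auto simp: good_list_def)
    ultimately show "good_list g xs" using good_list_of_proper[OF assms] by blast
  qed
  hence "{xs. good_list g xs} = proper_lists g \<union> (#) g ` proper_lists g" by blast
  thus ?thesis
    unfolding tuples_def tuples_p_def tuples_m_def by (auto simp: image_Un image_image)
qed

lemma tuples_eq_admissible:
  assumes "g \<ge> 1"
  shows "tuples g = {\<epsilon>. admissible g \<epsilon>}"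
proof (intro equalityI subsetI)
  fix \<epsilon> assume "\<epsilon> \<in> tuples g"
  then obtain xs where xs: "good_list g xs" and e: "\<epsilon> = infinite_tuple xs"
    using tuples_eq_good_lists[OF assms] by auto
  have "\<epsilon> k = 0" if "\<epsilon> (Suc k) = g" for k
  proof (cases "k = 0")
    case True
    thus ?thesis by (simp add: e infinite_tuple_def)
  next
    case False
    have k: "k < length xs" "xs ! k = g"
      using that assms by (auto simp: e infinite_tuple_def split: if_splits)
    have "xs ! Suc (k - 1) = g \<longrightarrow> xs ! (k - 1) = 0"
      using xs False k(1) unfolding good_list_def by (auto simp: successively_conv_nth)
    thus ?thesis using False k by (simp add: e infinite_tuple_def)
  qed
  moreover have "\<epsilon> k \<le> g" for k
    using xs by (auto simp: e infinite_tuple_def good_list_def)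
  moreover have "\<epsilon> k = 0" if "k > length xs" for k
    using that by (simp add: e infinite_tuple_def)
  moreover have "\<epsilon> 0 = 0" by (simp add: e infinite_tuple_def)
  ultimately show "\<epsilon> \<in> {\<epsilon>. admissible g \<epsilon>}"
    unfolding admissible_def by blast
next
  fix \<epsilon> assume "\<epsilon> \<in> {\<epsilon>. admissible g \<epsilon>}"
  hence adm: "admissible g \<epsilon>" by simp
  then obtain n where n: "\<forall>k>n. \<epsilon> k = 0" unfolding admissible_def by auto
  define xs where "xs = map \<epsilon> [1..<Suc n]"
  have "good_list g xs"
    using adm unfolding good_list_def admissible_def xs_def
    by (auto simp: successively_conv_nth simp del: upt_Suc)
  moreover have "\<epsilon> = infinite_tuple xs"
  proof
    fix k
    show "\<epsilon> k = infinite_tuple xs k"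
    proof (cases "1 \<le> k \<and> k \<le> n")
      case True
      hence "k - 1 < n" by linarith
      thus ?thesis using True by (simp add: infinite_tuple_def xs_def del: upt_Suc)
    next
      case False
      thus ?thesis using adm n
        by (cases "k = 0") (auto simp: infinite_tuple_def xs_def admissible_def simp del: upt_Suc)
    qed
  qed
  ultimately show "\<epsilon> \<in> tuples g" using tuples_eq_good_lists[OF assms] by auto
qed

lemma eval_tuple_eq_sum:
  assumes "\<forall>k>n. \<epsilon> k = 0"
  shows "eval_tuple G \<epsilon> = (\<Sum>k=1..n. \<epsilon> k * G k)"
proof -
  have "{k. 1 \<le> k \<and> \<epsilon> k \<noteq> 0} \<subseteq> {1..n}" using assms by (auto simp: not_less[symmetric])
  thus ?thesis unfolding eval_tuple_def by (intro sum.mono_neutral_left) auto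
qed

lemma eval_tuple_eq_0_iff:
  assumes "admissible g \<epsilon>" "\<forall>k\<ge>1. G k > 0"
  shows "eval_tuple G \<epsilon> = 0 \<longleftrightarrow> \<epsilon> = (\<lambda>_. 0)"
proof -
  obtain n where n: "\<forall>k>n. \<epsilon> k = 0" using assms unfolding admissible_def by auto
  have "eval_tuple G \<epsilon> = 0 \<longleftrightarrow> (\<forall>k\<in>{1..n}. \<epsilon> k = 0)"
    unfolding eval_tuple_eq_sum[OF n] using assms(2) by fastforce
  also have "\<dots> \<longleftrightarrow> (\<forall>k. \<epsilon> k = 0)"
    using n assms(1) unfolding admissible_def
    by (metis atLeastAtMost_iff not_le less_one)
  finally show ?thesis by auto
qed

section \<open>The greedy algorithm and the numeration system of the recurrence\<close>

text \<open>
  The top digit is \<open>n div G k\<close>, except that it is capped at \<open>g\<close>.  If it is \<open>g\<close>, the remainder is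
  below \<open>G (k - 1)\<close> and needs only the first \<open>k - 2\<close> digits, which leaves the required zero
  before \<open>g\<close>.  The bound on \<open>G 2\<close> makes one digit enough for the numbers below \<open>G 2\<close>.
\<close>

lemma ex_admissible_of_less:
  assumes "g \<ge> 1" "\<forall>k\<ge>1. G (k + 2) = g * G (k + 1) + G k" "G 1 = 1" "G 2 \<le> g + 1"
  shows "n < G (Suc k) \<Longrightarrow>
    \<exists>\<epsilon>. admissible g \<epsilon> \<and> (\<forall>i>k. \<epsilon> i = 0) \<and> (\<Sum>i=1..k. \<epsilon> i * G i) = n"
proof (induction k arbitrary: n rule: less_induct)
  case (less k)
  have ext: "\<exists>\<epsilon>. admissible g \<epsilon> \<and> (\<forall>i>k. \<epsilon> i = 0) \<and> (\<Sum>i=1..k. \<epsilon> i * G i) = q * G k + r"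
    if \<delta>: "admissible g \<delta>" "\<forall>i>j. \<delta> i = 0" "(\<Sum>i=1..j. \<delta> i * G i) = r"
      and j: "j < k" and q: "q < g \<or> q = g \<and> Suc j < k \<or> q = g \<and> k = 1" for \<delta> j q r
  proof -
    let ?\<epsilon> = "\<delta>(k := q)"
    have d: "admissible g ?\<epsilon>"
      unfolding admissible_def
    proof (intro conjI allI impI)
      show "?\<epsilon> 0 = 0" using j \<delta>(1) by (simp add: admissible_def)
      show "\<exists>n. \<forall>i>n. ?\<epsilon> i = 0" using \<delta>(2) j by (intro exI[of _ k]) auto
      show "?\<epsilon> i \<le> g" for i using \<delta>(1) q by (auto simp: admissible_def)
      fix i assume *: "?\<epsilon> (Suc i) = g"
      show "?\<epsilon> i = 0"
      proof (cases "Suc i = k")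
        case True
        with * q have "Suc j < k \<or> k = 1" by auto
        thus ?thesis using True \<delta>(1,2) by (auto simp: admissible_def)
      next
        case False
        hence "\<delta> (Suc i) = g" using * by simp
        hence "Suc i \<le> j" using \<delta>(2) assms(1) by (metis not_le not_one_le_zero)
        thus ?thesis using \<delta>(1) \<open>\<delta> (Suc i) = g\<close> j by (auto simp: admissible_def)
      qed
    qed
    have "(\<Sum>i=1..k. ?\<epsilon> i * G i) = q * G k + (\<Sum>i\<in>{1..k}-{k}. ?\<epsilon> i * G i)"
      using j by (subst sum.remove[of _ k]) auto
    also have "(\<Sum>i\<in>{1..k}-{k}. ?\<epsilon> i * G i) = (\<Sum>i=1..j. \<delta> i * G i)"
      using j \<delta>(2) by (intro sum.mono_neutral_cong_right) auto
    finally show ?thesis using d \<delta>(2,3) j by (intro exI[of _ ?\<epsilon>]) auto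
  qed
  have zero: "admissible g (\<lambda>_. 0)" by (simp add: admissible_def)
  consider "k = 0" | "k = 1" | "k \<ge> 2" by linarith
  thus ?case
  proof cases
    case 1
    thus ?thesis using less.prems assms(3) zero by (intro exI[of _ "\<lambda>_. 0"]) auto
  next
    case 2
    have "n \<le> g" using less.prems 2 assms(4) by (simp add: numeral_2_eq_2)
    thus ?thesis using ext[of "\<lambda>_. 0" 0 0 n] zero 2 assms(3) by (auto simp: le_less)
  next
    case 3
    have rec: "G (Suc k) = g * G k + G (k - 1)"
      using assms(2)[rule_format, of "k - 1"] 3 by (simp add: numeral_2_eq_2 Suc_diff_Suc)
    show ?thesis
    proof (cases "n \<ge> g * G k")
      case True
      hence "n - g * G k < G (Suc (k - 2))"
        using less.prems rec 3 by (simp add: numeral_2_eq_2 Suc_diff_Suc)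
      then obtain \<delta> where "admissible g \<delta>" "\<forall>i>k-2. \<delta> i = 0"
          "(\<Sum>i=1..k-2. \<delta> i * G i) = n - g * G k"
        using less.IH[of "k - 2" "n - g * G k"] 3 by auto
      from ext[OF this, of g] show ?thesis using 3 True by auto
    next
      case False
      hence "G k > 0" "n div G k < g"
        by (auto simp: not_le mult.commute less_mult_imp_div_less intro!: Nat.gr0I)
      moreover have "n mod G k < G (Suc (k - 1))" using \<open>G k > 0\<close> 3 by simp
      then obtain \<delta> where "admissible g \<delta>" "\<forall>i>k-1. \<delta> i = 0"
          "(\<Sum>i=1..k-1. \<delta> i * G i) = n mod G k"
        using less.IH[of "k - 1" "n mod G k"] 3 by auto
      ultimately show ?thesis using ext[of \<delta> "k-1" "n mod G k" "n div G k"] 3 by auto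
    qed
  qed
qed

lemma greedy_representation:
  assumes "g \<ge> 1" "\<forall>k\<ge>1. G (k + 2) = g * G (k + 1) + G k" "G 1 = 1" "G 2 \<le> g + 1" "G 2 \<ge> 1"
  shows "\<exists>\<epsilon>. admissible g \<epsilon> \<and> eval_tuple G \<epsilon> = n"
proof -
  have "G (Suc k) \<ge> 1 \<and> G (Suc (Suc k)) \<ge> Suc k" for k
  proof (induction k)
    case 0
    thus ?case using assms by (simp add: numeral_2_eq_2)
  next
    case (Suc k)
    have "G (Suc (Suc (Suc k))) = g * G (Suc (Suc k)) + G (Suc k)"
      using assms(2)[rule_format, of "Suc k"] by simp
    moreover have "g * G (Suc (Suc k)) \<ge> 1 * G (Suc (Suc k))"
      using assms(1) by (intro mult_right_mono) auto
    ultimately show ?case using Suc by linarith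
  qed
  hence "n < G (Suc (Suc n))" by (metis Suc_le_lessD)
  from ex_admissible_of_less[OF assms(1-4) this] show ?thesis
    using eval_tuple_eq_sum by metis
qed

fun grec :: "nat \<Rightarrow> nat \<Rightarrow> nat \<Rightarrow> nat \<Rightarrow> nat" where
  "grec g x y 0 = x"
| "grec g x y (Suc 0) = y"
| "grec g x y (Suc (Suc n)) = g * grec g x y (Suc n) + grec g x y n"

text \<open>
  For \<open>g = 1\<close> these are the Fibonacci numbers \<open>1, 2, 3, 5, \<dots>\<close> of the expansion of Zeckendorf.
\<close>

definition zseq :: "nat \<Rightarrow> nat \<Rightarrow> nat" where
  "zseq g k = grec g 1 (g + 1) (k - 1)"

lemma grec_shift_rec: "k \<ge> 1 \<Longrightarrow>
    grec g x y (k + 2 - 1) = g * grec g x y (k + 1 - 1) + grec g x y (k - 1)"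
  by (cases k) auto

lemma zeckendorf_ex:
  assumes "g \<ge> 1"
  shows "\<exists>\<epsilon>. admissible g \<epsilon> \<and> eval_tuple (zseq g) \<epsilon> = n"
proof (rule greedy_representation[OF assms])
  show "\<forall>k\<ge>1. zseq g (k + 2) = g * zseq g (k + 1) + zseq g k"
    unfolding zseq_def using grec_shift_rec by blast
qed (simp_all add: zseq_def)

lemma zseq_pos: "k \<ge> 1 \<Longrightarrow> zseq g k > 0"
proof -
  have "grec g 1 (g + 1) n > 0" for n by (induction n rule: induct_nat_012) auto
  thus ?thesis by (simp add: zseq_def)
qed

text \<open>
  The place value \<open>zseq g (Suc k)\<close> exceeds everything that the first \<open>k\<close> digits can contribute;
  a top digit \<open>g\<close> is compensated by the zero that precedes it.
\<close>

lemma zeckendorf_partial_sum_less: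
  assumes "g \<ge> 1" "admissible g \<epsilon>"
  shows "(\<Sum>i=1..k. \<epsilon> i * zseq g i) < zseq g (Suc k)"
proof (induction k rule: less_induct)
  case (less k)
  consider "k = 0" | "k = 1" | j where "k = Suc (Suc j)"
    by (metis One_nat_def not0_implies_Suc)
  thus ?case
  proof cases
    case 1
    thus ?thesis by (simp add: zseq_def)
  next
    case 2
    have "\<epsilon> 1 \<le> g" using assms(2) by (simp add: admissible_def)
    thus ?thesis using 2 by (simp add: zseq_def)
  next
    case 3
    have rec: "zseq g (Suc k) = g * zseq g k + zseq g (Suc j)" by (simp add: zseq_def 3)
    show ?thesis
    proof (cases "\<epsilon> k = g")
      case True
      hence "\<epsilon> (Suc j) = 0" using assms(2) 3 by (auto simp: admissible_def)
      moreover have "(\<Sum>i=1..j. \<epsilon> i * zseq g i) < zseq g (Suc j)" using less[of j] 3 by simp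
      ultimately show ?thesis unfolding rec using True 3 by simp
    next
      case False
      hence "Suc (\<epsilon> k) \<le> g" using assms(2) by (metis admissible_def le_neq_implies_less Suc_leI)
      hence "Suc (\<epsilon> k) * zseq g k \<le> g * zseq g k" by (rule mult_right_mono) auto
      moreover have "(\<Sum>i=1..Suc j. \<epsilon> i * zseq g i) < zseq g k" using less[of "Suc j"] 3 by simp
      ultimately show ?thesis unfolding rec using 3 by simp
    qed
  qed
qed

lemma zeckendorf_unique:
  assumes "g \<ge> 1" "admissible g \<epsilon>" "admissible g \<delta>"
    and "eval_tuple (zseq g) \<epsilon> = eval_tuple (zseq g) \<delta>"
  shows "\<epsilon> = \<delta>"
proof -
  have partial: "(\<Sum>i=1..n. \<epsilon> i * zseq g i) = (\<Sum>i=1..n. \<delta> i * zseq g i) \<Longrightarrow>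
      \<forall>i. 1 \<le> i \<and> i \<le> n \<longrightarrow> \<epsilon> i = \<delta> i" for n
  proof (induction n)
    case 0
    thus ?case by simp
  next
    case (Suc n)
    let ?z = "zseq g (Suc n)"
    have "(\<Sum>i=1..Suc n. \<eta> i * zseq g i) div ?z = \<eta> (Suc n)" if "admissible g \<eta>" for \<eta>
      using zeckendorf_partial_sum_less[OF assms(1) that, of n] by simp
    with Suc.prems assms have top: "\<epsilon> (Suc n) = \<delta> (Suc n)" by metis
    with Suc show ?case by (auto simp: le_Suc_eq)
  qed
  obtain m n where mn: "\<forall>k>m. \<epsilon> k = 0" "\<forall>k>n. \<delta> k = 0"
    using assms unfolding admissible_def by auto
  let ?M = "max m n"
  have "eval_tuple (zseq g) \<epsilon> = (\<Sum>k=1..?M. \<epsilon> k * zseq g k)"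
       "eval_tuple (zseq g) \<delta> = (\<Sum>k=1..?M. \<delta> k * zseq g k)"
    using mn by (intro eval_tuple_eq_sum; simp)+
  hence "(\<Sum>k=1..?M. \<epsilon> k * zseq g k) = (\<Sum>k=1..?M. \<delta> k * zseq g k)"
    using assms(4) by linarith
  from partial[OF this] have "\<forall>i. 1 \<le> i \<and> i \<le> ?M \<longrightarrow> \<epsilon> i = \<delta> i" .
  moreover have "\<epsilon> 0 = \<delta> 0" using assms by (simp add: admissible_def)
  ultimately have "\<epsilon> i = \<delta> i" for i
    using mn by (cases "i = 0"; cases "i \<le> ?M") auto
  thus ?thesis by auto
qed

section \<open>The window of a coefficient tuple\<close>

definition golden_conj :: "nat \<Rightarrow> real" where
  "golden_conj g = real g - golden_root g"

lemma golden_root_sq: "golden_root g ^ 2 = real g * golden_root g + 1"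
proof -
  have "sqrt (real g ^ 2 + 4) ^ 2 = real g ^ 2 + 4" by simp
  thus ?thesis unfolding golden_root_def power2_eq_square by (simp add: field_simps)
qed

lemma golden_root_gt: "golden_root g > real g" "golden_root g > 0"
proof -
  have "sqrt (real g ^ 2 + 4) > sqrt (real g ^ 2)" by (intro real_sqrt_less_mono) simp
  thus "golden_root g > real g" unfolding golden_root_def by simp
  thus "golden_root g > 0" by (meson le_less_trans of_nat_0_le_iff)
qed

lemma golden_root_mult_conj: "golden_root g * golden_conj g = -1"
  using golden_root_sq[of g] unfolding golden_conj_def by (simp add: power2_eq_square algebra_simps)

lemma golden_conj_sq: "golden_conj g ^ 2 = real g * golden_conj g + 1"
  using golden_root_sq[of g] unfolding golden_conj_def by (simp add: power2_eq_square algebra_simps)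

lemma golden_conj_neg: "golden_conj g < 0"
  using golden_root_gt unfolding golden_conj_def by simp

definition a_coord :: "nat \<Rightarrow> (nat \<Rightarrow> nat) \<Rightarrow> nat" where
  "a_coord g \<epsilon> = eval_tuple (\<lambda>k. grec g 0 1 (k - 1)) \<epsilon>"

definition b_coord :: "nat \<Rightarrow> (nat \<Rightarrow> nat) \<Rightarrow> nat" where
  "b_coord g \<epsilon> = eval_tuple (\<lambda>k. grec g 1 0 (k - 1)) \<epsilon>"

definition window_coord :: "nat \<Rightarrow> (nat \<Rightarrow> nat) \<Rightarrow> real" where
  "window_coord g \<epsilon> = real (b_coord g \<epsilon>) + golden_conj g * real (a_coord g \<epsilon>)"

lemma grec_linear: "grec g x y n = x * grec g 1 0 n + y * grec g 0 1 n"
  by (induction g x y n rule: grec.induct) (auto simp: algebra_simps)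

lemma grec_conj_power: "real (grec g 1 0 n) + golden_conj g * real (grec g 0 1 n) = golden_conj g ^ n"
proof (induction n rule: induct_nat_012)
  case (ge2 n)
  have "golden_conj g ^ Suc (Suc n) = golden_conj g ^ 2 * golden_conj g ^ n"
    by (simp add: power2_eq_square)
  also have "\<dots> = real g * golden_conj g ^ Suc n + golden_conj g ^ n"
    by (simp add: golden_conj_sq algebra_simps)
  also have "\<dots> = real (grec g 1 0 (Suc (Suc n))) + golden_conj g * real (grec g 0 1 (Suc (Suc n)))"
    unfolding ge2[symmetric] by (simp add: algebra_simps)
  finally show ?case ..
qed auto

lemma recurrence_eq_grec:
  assumes "\<forall>k\<ge>1. G (k + 2) = g * G (k + 1) + G k"
  shows "k \<ge> 1 \<Longrightarrow> G k = grec g (G 1) (G 2) (k - 1)"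
proof -
  have "G (Suc n) = grec g (G 1) (G 2) n" for n
  proof (induction n rule: induct_nat_012)
    case (ge2 n)
    thus ?case using assms[rule_format, of "Suc n"] by simp
  qed (simp_all add: numeral_2_eq_2)
  thus "k \<ge> 1 \<Longrightarrow> ?thesis" by (metis Suc_diff_1 less_le_trans zero_less_one)
qed

lemma eval_tuple_coords:
  assumes "admissible g \<epsilon>" "\<And>k. k \<ge> 1 \<Longrightarrow> G k = grec g x y (k - 1)"
  shows "eval_tuple G \<epsilon> = y * a_coord g \<epsilon> + x * b_coord g \<epsilon>"
proof -
  obtain n where n: "\<forall>k>n. \<epsilon> k = 0" using assms unfolding admissible_def by auto
  have "(\<Sum>k=1..n. \<epsilon> k * G k) =
      (\<Sum>k=1..n. \<epsilon> k * (x * grec g 1 0 (k - 1) + y * grec g 0 1 (k - 1)))"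
    by (intro sum.cong refl) (metis assms(2) atLeastAtMost_iff grec_linear)
  also have "\<dots> = y * (\<Sum>k=1..n. \<epsilon> k * grec g 0 1 (k - 1)) + x * (\<Sum>k=1..n. \<epsilon> k * grec g 1 0 (k - 1))"
    by (simp add: sum_distrib_left sum.distrib algebra_simps)
  finally show ?thesis unfolding a_coord_def b_coord_def eval_tuple_eq_sum[OF n] .
qed

lemma eval_zseq_coords:
  assumes "admissible g \<epsilon>"
  shows "eval_tuple (zseq g) \<epsilon> = (g + 1) * a_coord g \<epsilon> + b_coord g \<epsilon>"
  using eval_tuple_coords[OF assms, of "zseq g" 1 "g + 1"] by (simp add: zseq_def)

text \<open>
  The powers of \<open>\<beta>\<close> alternate in sign, so the extreme values come from the digits \<open>g, 0, g, 0, \<dots>\<close>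
  and \<open>0, g, 0, g, \<dots>\<close>.  The geometric series telescopes because \<open>g = \<alpha> * (1 - \<beta>\<^sup>2)\<close>, with
  limits \<open>\<alpha>\<close> and \<open>\<alpha> * \<beta> = -1\<close>, which a finite sum does not reach.
\<close>

lemma window:
  assumes "admissible g \<epsilon>"
  shows "-1 < window_coord g \<epsilon>" "window_coord g \<epsilon> < golden_root g"
proof -
  define \<alpha> \<beta> where "\<alpha> = golden_root g" and "\<beta> = golden_conj g"
  have neg: "\<beta> < 0" and ab: "\<alpha> * \<beta> = -1" and pos: "\<alpha> > 0"
    using golden_conj_neg golden_root_mult_conj golden_root_gt by (auto simp: \<alpha>_def \<beta>_def)
  have gsum: "real g = \<alpha> + \<beta>" by (simp add: \<alpha>_def \<beta>_def golden_conj_def)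
  obtain n where n: "\<forall>k>n. \<epsilon> k = 0" using assms unfolding admissible_def by auto
  define w where "w = (\<lambda>m. \<Sum>k=1..m. real (\<epsilon> k) * \<beta> ^ (k - 1))"
  have "window_coord g \<epsilon> = w (2 * n)"
  proof -
    have "\<forall>k>2 * n. \<epsilon> k = 0" using n by auto
    from eval_tuple_eq_sum[OF this] have "window_coord g \<epsilon> = (\<Sum>k=1..2*n. real (\<epsilon> k) *
        (real (grec g 1 0 (k - 1)) + \<beta> * real (grec g 0 1 (k - 1))))"
      unfolding window_coord_def a_coord_def b_coord_def
      by (simp add: \<beta>_def sum_distrib_left sum.distrib algebra_simps)
    thus ?thesis unfolding w_def \<beta>_def grec_conj_power .
  qed
  moreover have "-(1 - \<beta> ^ (2 * j)) \<le> w (2 * j) \<and> w (2 * j) \<le> \<alpha> * (1 - \<beta> ^ (2 * j))" for j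
  proof (induction j)
    case 0
    thus ?case by (simp add: w_def)
  next
    case (Suc j)
    let ?x = "real (\<epsilon> (2 * j + 1)) * \<beta> ^ (2 * j)"
    let ?y = "real (\<epsilon> (2 * j + 2)) * \<beta> * \<beta> ^ (2 * j)"
    have step: "w (2 * Suc j) = w (2 * j) + ?x + ?y" by (simp add: w_def)
    have P: "\<beta> ^ (2 * j) > 0" using neg by (simp add: power_mult)
    have le: "real (\<epsilon> k) \<le> \<alpha> + \<beta>" for k
      using assms unfolding gsum[symmetric] admissible_def by simp
    have x: "0 \<le> ?x" "?x \<le> (\<alpha> + \<beta>) * \<beta> ^ (2 * j)"
      using P le by (auto intro: mult_right_mono)
    have "(\<alpha> + \<beta>) * \<beta> \<le> real (\<epsilon> (2 * j + 2)) * \<beta>" "real (\<epsilon> (2 * j + 2)) * \<beta> \<le> 0"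
      using neg le by (auto intro: mult_right_mono_neg simp: mult_nonneg_nonpos)
    hence y: "?y \<le> 0" "(\<alpha> + \<beta>) * \<beta> * \<beta> ^ (2 * j) \<le> ?y"
      using P by (auto intro: mult_right_mono simp: mult_nonpos_nonneg)
    have sq: "\<beta> ^ (2 * Suc j) = \<beta>\<^sup>2 * \<beta> ^ (2 * j)" by (simp add: power2_eq_square)
    have "\<alpha> * \<beta>\<^sup>2 = - \<beta>" using ab by (simp add: power2_eq_square flip: mult.assoc)
    hence "\<alpha> * (1 - \<beta> ^ (2 * Suc j)) = \<alpha> * (1 - \<beta> ^ (2 * j)) + (\<alpha> + \<beta>) * \<beta> ^ (2 * j)"
      unfolding sq by (simp add: algebra_simps flip: mult.assoc)
    moreover have sqm: "(\<alpha> + \<beta>) * \<beta> = \<beta>\<^sup>2 - 1" using ab by (simp add: power2_eq_square algebra_simps)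
    then have "-(1 - \<beta> ^ (2 * Suc j)) = -(1 - \<beta> ^ (2 * j)) + (\<alpha> + \<beta>) * \<beta> * \<beta> ^ (2 * j)"
      unfolding sq sqm by (simp add: algebra_simps)
    ultimately show ?case using Suc x y step by linarith
  qed
  moreover have "\<beta> ^ (2 * n) > 0" using neg by (simp add: power_mult)
  hence "\<alpha> * (1 - \<beta> ^ (2 * n)) < \<alpha>" using pos by (simp add: algebra_simps)
  ultimately show "-1 < window_coord g \<epsilon>" "window_coord g \<epsilon> < golden_root g"
    using \<open>\<beta> ^ (2 * n) > 0\<close> unfolding \<alpha>_def
    by (smt (verit))+
qed


section \<open>The ratio as a quotient of window length and step\<close>

abbreviation denom :: "nat \<Rightarrow> (nat \<Rightarrow> nat) \<Rightarrow> real" where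
  "denom g G \<equiv> real (G 2) * golden_root g + real (G 1)"

lemma expansion_ratio_eq:
  "expansion_ratio g G = golden_root g * (1 + golden_root g) / denom g G"
  using golden_root_sq[of g] unfolding expansion_ratio_def by (simp add: power2_eq_square algebra_simps)

lemma step_eq: "real (G 2) - golden_conj g * real (G 1) = denom g G / golden_root g"
proof (rule eq_divide_imp)
  have "(real (G 2) - golden_conj g * real (G 1)) * golden_root g =
      real (G 2) * golden_root g - (golden_root g * golden_conj g) * real (G 1)"
    by (simp add: algebra_simps)
  thus "(real (G 2) - golden_conj g * real (G 1)) * golden_root g = denom g G"
    by (simp add: golden_root_mult_conj)
qed (use golden_root_gt(2)[of g] in simp)

lemma denom_pos:
  assumes "G \<in> golden_recurrences g"
  shows "denom g G > 0"
  using assms golden_root_gt unfolding golden_recurrences_def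
  by (auto intro!: add_nonneg_pos mult_nonneg_nonneg simp: less_imp_le)

lemma ratio_pos:
  assumes "G \<in> golden_recurrences g"
  shows "expansion_ratio g G > 0"
  using denom_pos[OF assms] golden_root_gt by (simp add: expansion_ratio_eq add_pos_pos)

lemma ratio_le_1_iff:
  assumes "G \<in> golden_recurrences g"
  shows "expansion_ratio g G \<le> 1 \<longleftrightarrow> 1 + golden_root g \<le> real (G 2) - golden_conj g * real (G 1)"
  using denom_pos[OF assms] golden_root_gt(2)[of g] unfolding expansion_ratio_eq step_eq
  by (simp add: pos_le_divide_eq pos_divide_le_eq mult.commute)

lemma ratio_ge_1_iff:
  assumes "G \<in> golden_recurrences g"
  shows "expansion_ratio g G \<ge> 1 \<longleftrightarrow> real (G 2) - golden_conj g * real (G 1) \<le> 1 + golden_root g"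
  using denom_pos[OF assms] golden_root_gt(2)[of g] unfolding expansion_ratio_eq step_eq
  by (simp add: pos_le_divide_eq pos_divide_le_eq mult.commute)

text \<open>
  The linear form \<open>(g + 1) * a + b - r * (G 2 * a + G 1 * b)\<close> vanishes at the dominant
  eigenvector \<open>(a, b) = (\<alpha>, 1)\<close> of the recurrence, and is therefore a multiple of the window
  coordinate.
\<close>

lemma ratio_identity:
  fixes a b :: real
  assumes "G \<in> golden_recurrences g"
  shows "(real g + 1) * a + b - expansion_ratio g G * (real (G 2) * a + real (G 1) * b) =
    (real (G 2) - (real g + 1) * real (G 1)) * golden_root g / denom g G * (b + golden_conj g * a)"
proof -
  define \<alpha> where "\<alpha> = golden_root g"
  have "\<alpha> * (b + golden_conj g * a) = \<alpha> * b + (\<alpha> * golden_conj g) * a"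
    by (simp add: algebra_simps)
  also have "\<dots> = \<alpha> * b - a" by (simp add: \<alpha>_def golden_root_mult_conj)
  finally have *: "\<alpha> * (b + golden_conj g * a) = \<alpha> * b - a" .
  have Dr: "denom g G * expansion_ratio g G = (real g + 1) * \<alpha> + 1"
    using denom_pos[OF assms] by (simp add: expansion_ratio_def \<alpha>_def)
  let ?c = "real (G 2) - (real g + 1) * real (G 1)"
  let ?lhs = "(real g + 1) * a + b - expansion_ratio g G * (real (G 2) * a + real (G 1) * b)"
  have "?lhs * denom g G = denom g G * ((real g + 1) * a + b)
      - (denom g G * expansion_ratio g G) * (real (G 2) * a + real (G 1) * b)"
    by (simp add: algebra_simps)
  also have "\<dots> = ?c * (\<alpha> * b - a)" unfolding Dr unfolding \<alpha>_def[symmetric] by (simp add: algebra_simps)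
  also have "\<dots> = ?c * \<alpha> * (b + golden_conj g * a)" by (simp only: * mult.assoc)
  finally have "?lhs = ?c * \<alpha> * (b + golden_conj g * a) / denom g G"
    using denom_pos[OF assms] by (intro eq_divide_imp) auto
  thus ?thesis by (simp only: \<alpha>_def times_divide_eq_left)
qed

lemma eval_golden_coords:
  assumes "G \<in> golden_recurrences g" "admissible g \<epsilon>"
  shows "eval_tuple G \<epsilon> = G 2 * a_coord g \<epsilon> + G 1 * b_coord g \<epsilon>"
  using eval_tuple_coords[OF assms(2) recurrence_eq_grec] assms(1)
  unfolding golden_recurrences_def by auto

lemma eval_zseq_close_to_ratio_mult:
  assumes "G \<in> golden_recurrences g"
  obtains C where "\<And>\<epsilon>. admissible g \<epsilon> \<Longrightarrow>
    \<bar>real (eval_tuple (zseq g) \<epsilon>) - expansion_ratio g G * real (eval_tuple G \<epsilon>)\<bar> \<le> C"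
proof
  fix \<epsilon> assume \<epsilon>: "admissible g \<epsilon>"
  let ?K = "(real (G 2) - (real g + 1) * real (G 1)) * golden_root g / denom g G"
  have "real (eval_tuple (zseq g) \<epsilon>) - expansion_ratio g G * real (eval_tuple G \<epsilon>) =
      ?K * window_coord g \<epsilon>"
    using ratio_identity[OF assms, of "real (a_coord g \<epsilon>)" "real (b_coord g \<epsilon>)"]
    unfolding window_coord_def eval_golden_coords[OF assms \<epsilon>] eval_zseq_coords[OF \<epsilon>]
    by (simp only: of_nat_add of_nat_mult of_nat_1)
  moreover have "\<bar>window_coord g \<epsilon>\<bar> \<le> 1 + golden_root g"
    using window[OF \<epsilon>] golden_root_gt(2)[of g] by linarith
  ultimately show "\<bar>real (eval_tuple (zseq g) \<epsilon>) - expansion_ratio g G * real (eval_tuple G \<epsilon>)\<bar>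
      \<le> \<bar>?K\<bar> * (1 + golden_root g)"
    by (simp only: abs_mult mult_left_mono abs_ge_zero)
qed

section \<open>Unique expansions and represented numbers\<close>

lemma unique_expansion_of_ratio_le_1:
  assumes "g \<ge> 1" "G \<in> golden_recurrences g" "expansion_ratio g G \<le> 1"
  shows "unique_expansion g G"
  unfolding unique_expansion_def tuples_eq_admissible[OF assms(1)]
proof (rule inj_onI, simp)
  fix \<epsilon> \<delta> assume ad: "admissible g \<epsilon>" "admissible g \<delta>" and eq: "eval_tuple G \<epsilon> = eval_tuple G \<delta>"
  define a b where "a = int (a_coord g \<epsilon>) - int (a_coord g \<delta>)"
    and "b = int (b_coord g \<delta>) - int (b_coord g \<epsilon>)"
  have G: "coprime (int (G 1)) (int (G 2))" "G 1 > 0"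
    using assms(2) by (auto simp: golden_recurrences_def)
  have "int (G 2 * a_coord g \<epsilon> + G 1 * b_coord g \<epsilon>) = int (G 2 * a_coord g \<delta> + G 1 * b_coord g \<delta>)"
    using eq ad by (simp only: eval_golden_coords[OF assms(2)])
  hence ab: "int (G 2) * a = int (G 1) * b"
    by (simp add: a_def b_def algebra_simps)
  hence "int (G 1) dvd a" using G(1) by (metis coprime_dvd_mult_right_iff dvd_triv_left)
  then obtain t where a: "a = int (G 1) * t" by (elim dvdE)
  with ab G(2) have b: "b = int (G 2) * t" by simp
  let ?s = "real (G 2) - golden_conj g * real (G 1)"
  have "window_coord g \<delta> - window_coord g \<epsilon> = of_int b - golden_conj g * of_int a"
    by (simp add: window_coord_def a_def b_def algebra_simps)
  also have "\<dots> = of_int t * ?s" by (simp add: a b algebra_simps)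
  finally have "\<bar>of_int t * ?s\<bar> < 1 + golden_root g"
    using window[OF ad(1)] window[OF ad(2)] by linarith
  moreover have s: "?s \<ge> 1 + golden_root g" using ratio_le_1_iff assms(2,3) by blast
  hence s0: "?s \<ge> 0" using golden_root_gt(2)[of g] by linarith
  ultimately have "\<bar>of_int t\<bar> * ?s < 1 + golden_root g"
    by (simp only: abs_mult abs_of_nonneg)
  hence "\<bar>of_int t\<bar> * ?s < 1 * ?s" using s by (simp only: mult_1)
  hence "\<bar>of_int t :: real\<bar> < 1" using s0 by (rule mult_right_less_imp_less)
  hence "t = 0" by linarith
  hence "a_coord g \<epsilon> = a_coord g \<delta>" "b_coord g \<epsilon> = b_coord g \<delta>"
    using a b by (simp_all add: a_def b_def)
  thus "\<epsilon> = \<delta>" using zeckendorf_unique[OF assms(1) ad] by (simp add: eval_zseq_coords ad)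
qed

text \<open>
  The tuple is the expansion of \<open>(g + 1) * a + b\<close> under \<open>zseq\<close>.  Its own lattice point has the
  same value of this form, so the two window coordinates differ by a multiple of
  \<open>g + 1 - \<beta> = 1 + \<alpha>\<close>, the full length of the window; as the coordinate of a tuple
  avoids both end points, the points coincide.
\<close>

lemma lattice_point_in_window:
  fixes a b :: int
  assumes "g \<ge> 1" "(int g + 1) * a + b \<ge> 0"
    and "-1 \<le> of_int b + golden_conj g * of_int a" "of_int b + golden_conj g * of_int a < golden_root g"
  obtains \<epsilon> where "admissible g \<epsilon>" "int (a_coord g \<epsilon>) = a" "int (b_coord g \<epsilon>) = b"
proof -
  obtain \<epsilon> where \<epsilon>: "admissible g \<epsilon>" "eval_tuple (zseq g) \<epsilon> = nat ((int g + 1) * a + b)"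
    using zeckendorf_ex[OF assms(1)] by blast
  define t where "t = a - int (a_coord g \<epsilon>)"
  have "int ((g + 1) * a_coord g \<epsilon> + b_coord g \<epsilon>) = (int g + 1) * a + b"
    using \<epsilon>(2) assms(2) unfolding eval_zseq_coords[OF \<epsilon>(1)] by (simp only: nat_0_le)
  hence b: "b = int (b_coord g \<epsilon>) - (int g + 1) * t" by (simp add: t_def algebra_simps)
  have "window_coord g \<epsilon> - (of_int b + golden_conj g * of_int a) =
      of_int t * (real g + 1 - golden_conj g)"
    unfolding b window_coord_def t_def by (simp add: algebra_simps)
  also have "real g + 1 - golden_conj g = 1 + golden_root g" by (simp add: golden_conj_def)
  finally have "\<bar>of_int t * (1 + golden_root g)\<bar> < 1 + golden_root g"
    using window[OF \<epsilon>(1)] assms(3,4) by linarith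
  hence "\<bar>of_int t\<bar> * (1 + golden_root g) < 1 * (1 + golden_root g)"
    using golden_root_gt(2)[of g] by (simp add: abs_mult)
  moreover have "0 \<le> 1 + golden_root g" using golden_root_gt(2)[of g] by linarith
  ultimately have "\<bar>of_int t :: real\<bar> < 1" by (rule mult_right_less_imp_less)
  hence "t = 0" by linarith
  thus ?thesis using that \<epsilon>(1) b by (simp add: t_def)
qed

lemma represented_of_ratio_ge_1:
  assumes "g \<ge> 1" "G \<in> golden_recurrences g" "expansion_ratio g G \<ge> 1"
  obtains n0 where "\<And>n. n \<ge> n0 \<Longrightarrow> n \<in> represented g G"
proof -
  define K where "K = (real (G 2) - (real g + 1) * real (G 1)) * golden_root g / denom g G"
  define n0 where "n0 = nat \<lceil>\<bar>K\<bar> * (1 + golden_root g)\<rceil> + 1"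
  let ?\<beta> = "golden_conj g" and ?s = "real (G 2) - golden_conj g * real (G 1)"
  have \<alpha>: "golden_root g > 0" by (rule golden_root_gt)
  have s: "?s > 0" "?s \<le> 1 + golden_root g"
  proof -
    show "?s > 0" using denom_pos[OF assms(2)] \<alpha> unfolding step_eq by simp
    show "?s \<le> 1 + golden_root g" using ratio_ge_1_iff[OF assms(2)] assms(3) by blast
  qed
  have cop: "gcd (int (G 2)) (int (G 1)) = 1"
    using assms(2) by (simp add: golden_recurrences_def coprime_commute)
  have "n \<in> represented g G" if "n \<ge> n0" for n
  proof -
    obtain u v where uv: "u * int (G 2) + v * int (G 1) = 1"
      using bezout_int[of "int (G 2)" "int (G 1)"] cop by auto
    define w0 where "w0 = of_int (v * int n) + ?\<beta> * of_int (u * int n)"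
    define t where "t = \<lfloor>(w0 + 1) / ?s\<rfloor>"
    define a b where "a = u * int n + t * int (G 1)" and "b = v * int n - t * int (G 2)"
    define w where "w = of_int b + ?\<beta> * of_int a"
    have "int (G 2) * a + int (G 1) * b = (u * int (G 2) + v * int (G 1)) * int n"
      unfolding a_def b_def by (simp add: algebra_simps)
    hence n: "int (G 2) * a + int (G 1) * b = int n" using uv by simp
    \<comment> \<open>The rounding puts the point into the part of the window of length one step above \<open>-1\<close>.\<close>
    have "w = w0 - of_int t * ?s" unfolding w_def w0_def a_def b_def by (simp add: algebra_simps)
    moreover have "of_int t \<le> (w0 + 1) / ?s" "(w0 + 1) / ?s < of_int t + 1"
      unfolding t_def by linarith+
    hence "of_int t * ?s \<le> w0 + 1" "w0 + 1 < (of_int t + 1) * ?s"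
      using s by (simp_all only: pos_le_divide_eq pos_divide_less_eq)
    ultimately have w: "-1 \<le> w" "w < golden_root g"
      using s by (simp_all add: algebra_simps)
    have "real_of_int ((int g + 1) * a + b) = expansion_ratio g G * real_of_int (int (G 2) * a + int (G 1) * b) + K * w"
      using ratio_identity[OF assms(2), of "of_int a" "of_int b"] by (simp add: K_def w_def)
    hence "real_of_int ((int g + 1) * a + b) = expansion_ratio g G * real n + K * w"
      unfolding n by simp
    moreover have "1 * real n \<le> expansion_ratio g G * real n"
      using assms(3) by (intro mult_right_mono) auto
    moreover have "\<bar>w\<bar> \<le> 1 + golden_root g" using w \<alpha> by linarith
    hence "\<bar>K * w\<bar> \<le> \<bar>K\<bar> * (1 + golden_root g)"
      by (simp only: abs_mult mult_left_mono abs_ge_zero)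
    moreover have "\<bar>K\<bar> * (1 + golden_root g) \<le> real n" using that unfolding n0_def by linarith
    ultimately have "real_of_int ((int g + 1) * a + b) \<ge> 0" by linarith
    hence "(int g + 1) * a + b \<ge> 0" by linarith
    then obtain \<epsilon> where \<epsilon>: "admissible g \<epsilon>" "int (a_coord g \<epsilon>) = a" "int (b_coord g \<epsilon>) = b"
      using lattice_point_in_window[OF assms(1)] w unfolding w_def by blast
    have "int (eval_tuple G \<epsilon>) = int n"
      unfolding eval_golden_coords[OF assms(2) \<epsilon>(1)] using n \<epsilon>(2,3) by simp
    moreover have "n \<ge> 1" using that by (simp add: n0_def)
    ultimately show ?thesis
      unfolding represented_def tuples_eq_admissible[OF assms(1)] using \<epsilon>(1) by auto
  qed
  thus ?thesis using that by blast
qed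

section \<open>Counting represented numbers\<close>

lemma finite_represented_upto: "finite (represented_upto g G X)"
  by (rule finite_subset[of _ "{..X}"]) (auto simp: represented_upto_def)

lemma card_represented_upto_le: "card (represented_upto g G X) \<le> X"
proof -
  have "represented_upto g G X \<subseteq> {1..X}" by (auto simp: represented_upto_def represented_def)
  from card_mono[OF _ this] show ?thesis by simp
qed

text \<open>
  A represented number has a unique tuple, hence a unique value under \<open>zseq\<close>.  Since that
  value is \<open>r * n\<close> up to a bounded error, the values for \<open>n \<le> X\<close> contain every positive integer
  up to \<open>r * X - C\<close> and none beyond \<open>r * X + C\<close>.
\<close>

lemma count_asymptotics:
  assumes "g \<ge> 1" "G \<in> golden_recurrences g" "unique_expansion g G"
  shows "(\<lambda>X. real (card (represented_upto g G X)) - expansion_ratio g G * real X) \<in> O(\<lambda>_. 1)"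
proof -
  define r where "r = expansion_ratio g G"
  have r: "r > 0" unfolding r_def by (rule ratio_pos[OF assms(2)])
  let ?f = "eval_tuple G" and ?m = "eval_tuple (zseq g)"
  obtain C where C: "\<And>\<epsilon>. admissible g \<epsilon> \<Longrightarrow> \<bar>real (?m \<epsilon>) - r * real (?f \<epsilon>)\<bar> \<le> C"
    using eval_zseq_close_to_ratio_mult[OF assms(2)] unfolding r_def by blast
  have Gpos: "\<forall>k\<ge>1. G k > 0" and zpos: "\<forall>k\<ge>1. zseq g k > 0"
    using assms(2) zseq_pos by (auto simp: golden_recurrences_def)
  have C0: "C \<ge> 0" using C[of "\<lambda>_. 0"] by (auto simp: admissible_def)
  have bound: "\<bar>real (card (represented_upto g G X)) - r * real X\<bar> \<le> C + 1" for X
  proof -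
    define E where "E = {\<epsilon>. admissible g \<epsilon> \<and> 1 \<le> ?f \<epsilon> \<and> ?f \<epsilon> \<le> X}"
    have inj: "inj_on ?f E" "inj_on ?m E"
      using assms(3) zeckendorf_unique[OF assms(1)]
      unfolding unique_expansion_def tuples_eq_admissible[OF assms(1)] E_def
      by (auto simp: inj_on_def)
    have "represented_upto g G X = ?f ` E"
      unfolding represented_upto_def represented_def tuples_eq_admissible[OF assms(1)] E_def by auto
    hence card: "card (represented_upto g G X) = card (?m ` E)"
      by (simp add: card_image inj)
    have "?m ` E \<subseteq> {1..nat \<lfloor>r * real X + C\<rfloor>}"
    proof
      fix m assume "m \<in> ?m ` E"
      then obtain \<epsilon> where \<epsilon>: "admissible g \<epsilon>" "1 \<le> ?f \<epsilon>" "?f \<epsilon> \<le> X" "m = ?m \<epsilon>"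
        by (auto simp: E_def)
      have "m \<noteq> 0"
        using \<epsilon> eval_tuple_eq_0_iff[OF \<epsilon>(1) Gpos] eval_tuple_eq_0_iff[OF \<epsilon>(1) zpos] by auto
      moreover have "r * real (?f \<epsilon>) \<le> r * real X" using \<epsilon>(3) r by simp
      hence "real m \<le> r * real X + C" using C[OF \<epsilon>(1)] \<epsilon>(4) by linarith
      hence "m \<le> nat \<lfloor>r * real X + C\<rfloor>" by linarith
      ultimately show "m \<in> {1..nat \<lfloor>r * real X + C\<rfloor>}" by auto
    qed
    note fin = finite_subset[OF this finite_atLeastAtMost]
    from card_mono[OF finite_atLeastAtMost \<open>?m ` E \<subseteq> {1..nat \<lfloor>r * real X + C\<rfloor>}\<close>]
    have "card (?m ` E) \<le> nat \<lfloor>r * real X + C\<rfloor>" by simp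
    moreover have "0 \<le> r * real X + C" using r C0 by simp
    ultimately have upper: "real (card (?m ` E)) \<le> r * real X + C" by linarith
    have "{1..nat \<lfloor>r * real X - C\<rfloor>} \<subseteq> ?m ` E"
    proof
      fix m assume m: "m \<in> {1..nat \<lfloor>r * real X - C\<rfloor>}"
      obtain \<epsilon> where \<epsilon>: "admissible g \<epsilon>" "?m \<epsilon> = m" using zeckendorf_ex[OF assms(1)] by blast
      have "?f \<epsilon> \<noteq> 0"
        using m \<epsilon>(2) eval_tuple_eq_0_iff[OF \<epsilon>(1) Gpos] eval_tuple_eq_0_iff[OF \<epsilon>(1) zpos] by auto
      moreover have "real m \<le> r * real X - C"
      proof -
        have "1 \<le> m" "m \<le> nat \<lfloor>r * real X - C\<rfloor>" using m by auto
        thus ?thesis by linarith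
      qed
      hence "r * real (?f \<epsilon>) \<le> r * real X" using C[OF \<epsilon>(1)] \<epsilon>(2) by linarith
      hence "?f \<epsilon> \<le> X" using r by simp
      ultimately show "m \<in> ?m ` E" using \<epsilon> by (force simp: E_def)
    qed
    from card_mono[OF fin this]
    have "nat \<lfloor>r * real X - C\<rfloor> \<le> card (?m ` E)" by simp
    hence "r * real X - C - 1 \<le> real (card (?m ` E))" by linarith
    with upper show ?thesis unfolding card by linarith
  qed
  thus ?thesis unfolding r_def[symmetric] by (intro bigoI[of _ "C + 1"]) simp
qed

lemma density_eq_of_bounded_error:
  assumes "(\<lambda>X. real (card (represented_upto g G X)) - r * real X) \<in> O(\<lambda>_. 1)"
  shows "representation_density g G = r"
proof -
  define e where "e = (\<lambda>X. real (card (represented_upto g G X)) - r * real X)"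
  have "(\<lambda>_. 1) \<in> o(\<lambda>X. real X)"
    by (rule smalloI_tendsto) (auto simp: lim_1_over_n eventually_gt_at_top)
  with assms have "e \<in> o(\<lambda>X. real X)"
    unfolding e_def by (rule landau_o.big_small_trans)
  hence "(\<lambda>X. e X / real X) \<longlonglongrightarrow> 0" by (rule smalloD_tendsto)
  hence "(\<lambda>X. r + e X / real X) \<longlonglongrightarrow> r + 0" by (intro tendsto_intros)
  moreover have "eventually (\<lambda>X. r + e X / real X = real (card (represented_upto g G X)) / real X) sequentially"
    using eventually_gt_at_top[of 0] by eventually_elim (simp add: e_def field_simps)
  ultimately have "(\<lambda>X. real (card (represented_upto g G X)) / real X) \<longlonglongrightarrow> r"
    using tendsto_cong by fastforce
  thus ?thesis unfolding representation_density_def by (rule limI)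
qed

lemma count_cofinite:
  assumes "\<And>n. n \<ge> n0 \<Longrightarrow> n \<in> represented g G"
  shows "(\<lambda>X. real (card (represented_upto g G X)) - real X) \<in> O(\<lambda>_. 1)"
proof -
  have "\<bar>real (card (represented_upto g G X)) - real X\<bar> \<le> real n0" for X
  proof -
    have "{n0..X} \<subseteq> represented_upto g G X" using assms by (auto simp: represented_upto_def)
    from card_mono[OF finite_represented_upto this]
    show ?thesis using card_represented_upto_le[of g G X] by simp
  qed
  thus ?thesis by (intro bigoI[of _ "real n0"]) simp
qed

text \<open>
  In the cases that involve \<open>r\<close> the comparison of \<open>r\<close> with \<open>1\<close> amounts to comparing \<open>denom g G\<close>
  with \<open>(g + 1) * \<alpha> + 1\<close>.  When \<open>G 2 = 1\<close> the threshold for \<open>G 1\<close> is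
  \<open>g * \<alpha> + 1 = \<alpha>\<^sup>2\<close>, which lies strictly between \<open>g\<^sup>2 + 1\<close> and \<open>g\<^sup>2 + 2\<close>.
\<close>

theorem theorem2p15:
  fixes g :: nat and G :: "nat \<Rightarrow> nat" and N :: "nat \<Rightarrow> real" and p r :: real
  assumes "g \<ge> 1"
    and "G \<in> golden_recurrences g"
  defines "N \<equiv> \<lambda>X. real (card (represented_upto g G X))"
    and "p \<equiv> representation_density g G"
    and "r \<equiv> expansion_ratio g G"
  shows "(G 1 = 1 \<and> G 2 \<le> g \<longrightarrow> (\<forall>X\<ge>1. N X = real X)) \<and>
         (G 1 = 1 \<and> G 2 > g \<longrightarrow>
            unique_expansion g G \<and>
            (\<lambda>X. N X - p * real X) \<in> O(\<lambda>_. 1) \<and> p = r \<and>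
            r \<le> 1 \<and> (G 2 \<noteq> g + 1 \<longrightarrow> r < 1)) \<and>
         (G 2 = 1 \<and> G 1 \<le> g ^ 2 + 1 \<longrightarrow> (\<lambda>X. N X - real X) \<in> O(\<lambda>_. 1)) \<and>
         (G 2 = 1 \<and> G 1 > g ^ 2 + 1 \<longrightarrow>
            unique_expansion g G \<and>
            (\<lambda>X. N X - p * real X) \<in> O(\<lambda>_. 1) \<and> p = r \<and> r < 1)"
proof -
  define \<alpha> where "\<alpha> = golden_root g"
  have \<alpha>: "\<alpha> > real g" "\<alpha> > 0" "\<alpha> * \<alpha> = real g * \<alpha> + 1"
    using golden_root_gt golden_root_sq[of g] by (auto simp: \<alpha>_def power2_eq_square)
  have D: "real (G 2) * \<alpha> + real (G 1) > 0"
    using denom_pos[OF assms(2)] by (simp add: \<alpha>_def)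
  have r_eq: "r = ((real g + 1) * \<alpha> + 1) / (real (G 2) * \<alpha> + real (G 1))"
    by (simp add: r_def expansion_ratio_def \<alpha>_def)
  have unique: "unique_expansion g G \<and> (\<lambda>X. N X - p * real X) \<in> O(\<lambda>_. 1) \<and> p = r" if "r \<le> 1"
  proof -
    have "unique_expansion g G"
      using unique_expansion_of_ratio_le_1 assms(1,2) that unfolding r_def by blast
    moreover from count_asymptotics[OF assms(1,2) this]
    have *: "(\<lambda>X. N X - r * real X) \<in> O(\<lambda>_. 1)" by (simp add: N_def r_def)
    moreover have "p = r" unfolding p_def by (rule density_eq_of_bounded_error) (use * in \<open>simp add: N_def\<close>)
    ultimately show ?thesis by simp
  qed
  have a1: "N X = real X" if "G 1 = 1" "G 2 \<le> g" for X
  proof -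
    have rec: "\<forall>k\<ge>1. G (k + 2) = g * G (k + 1) + G k" "G 2 \<ge> 1"
      using assms(2) by (auto simp: golden_recurrences_def Suc_le_eq)
    have "n \<in> represented g G" if "n \<ge> 1" for n
      using greedy_representation[OF assms(1) rec(1) \<open>G 1 = 1\<close> _ rec(2), of n] \<open>G 2 \<le> g\<close> that
      unfolding represented_def tuples_eq_admissible[OF assms(1)] by auto
    hence "{1..X} \<subseteq> represented_upto g G X" by (auto simp: represented_upto_def)
    from card_mono[OF finite_represented_upto this] show ?thesis
      using card_represented_upto_le[of g G X] by (simp add: N_def)
  qed
  have a2: "r \<le> 1 \<and> (G 2 \<noteq> g + 1 \<longrightarrow> r < 1)" if "G 1 = 1" "G 2 > g"
  proof -
    have "(real g + 1) * \<alpha> \<le> real (G 2) * \<alpha>"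
      using that \<alpha>(2) by (intro mult_right_mono) auto
    moreover have "(real g + 1) * \<alpha> < real (G 2) * \<alpha>" if "G 2 \<noteq> g + 1"
      using that \<open>G 2 > g\<close> \<alpha>(2) by (intro mult_strict_right_mono) auto
    ultimately show ?thesis using D that(1) by (auto simp: r_eq)
  qed
  have b1: "(\<lambda>X. N X - real X) \<in> O(\<lambda>_. 1)" if "G 2 = 1" "G 1 \<le> g ^ 2 + 1"
  proof -
    have "real (G 1) \<le> real g * real g + 1"
      using that(2) by (metis of_nat_1 of_nat_add of_nat_le_iff of_nat_mult power2_eq_square)
    moreover have "real g * real g \<le> real g * \<alpha>" using \<alpha>(1) by (intro mult_left_mono) auto
    ultimately have "r \<ge> 1" using D that(1) by (simp add: r_eq algebra_simps)
    then obtain n0 where "\<And>n. n \<ge> n0 \<Longrightarrow> n \<in> represented g G"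
      using represented_of_ratio_ge_1[OF assms(1,2)] unfolding r_def by blast
    from count_cofinite[OF this] show ?thesis by (simp add: N_def)
  qed
  have b2: "r < 1" if "G 2 = 1" "G 1 > g ^ 2 + 1"
  proof -
    have "real (G 1) \<ge> real (g ^ 2 + 2)" using that(2) by (intro of_nat_mono) simp
    hence G1: "real (G 1) \<ge> real g * real g + 2" by (simp add: power2_eq_square)
    \<comment> \<open>\<open>\<alpha> = g + 1 / \<alpha>\<close> and \<open>g < \<alpha>\<close> give \<open>g * \<alpha> < g\<^sup>2 + 1\<close>.\<close>
    have "real g * (\<alpha> - real g) < \<alpha> * (\<alpha> - real g)"
      using \<alpha>(1) by (intro mult_strict_right_mono) auto
    also have "\<dots> = 1" using \<alpha>(3) by (simp add: algebra_simps)
    finally have "real g * \<alpha> < real g * real g + 1" by (simp add: algebra_simps)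
    thus ?thesis using D that(1) G1 by (simp add: r_eq algebra_simps)
  qed
  show ?thesis using a1 a2 b1 b2 unique by (auto simp: less_imp_le)
qed

end
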